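(* Let $n\ge 2$ and let $\mathbf{A}=[a_{ij}]$ be an $n\times n$ reciprocal pairwise comparison matrix with Koczkodaj's inconsistency index $KI(\mathbf{A})$, and put $\kappa = 1-KI(\mathbf{A})$. Let $w^{EV}$ and $w^{GM}$ be the normalized priority vectors of the $n$ compared objects obtained from $\mathbf{A}$ by the eigenvalue method and by the geometric mean method, respectively. Let the objects $O_1,\dots,O_n$ be numbered from the best to the worst according to the eigenvalue method, so that $w_1^{EV}\ge w_2^{EV}\ge\dots\ge w_n^{EV}$. Let $d^{*}=w_1^{EV}-w_2^{EV}$. If $$d^{*}>\frac{1}{\kappa^2}-1\ge MD(w^{EV},w^{GM}),$$ then the object ranked first by the eigenvalue method (namely $O_1$) is also ranked first by the geometric mean method.
   Context: A pairwise comparison (PC) matrix of $n$ objects is an $n\times n$ real matrix $\mathbf{A}=[a_{ij}]$ with $a_{ij}>0$ and $a_{ii}=1$; it is reciprocal if $a_{ij}=1/a_{ji}$ for all $i,j$. All PC matrices are assumed reciprocal. Koczkodaj's inconsistency index is $$KI(\mathbf{A})=\max\left\{1-\min\left\{\frac{a_{ij}}{a_{ik}a_{kj}},\frac{a_{ik}a_{kj}}{a_{ij}}\right\} : i,j,k\in\{1,\dots,n\}\right\},$$ so $0\le KI(\mathbf{A})<1$. Eigenvalue (EV) method: $w^{EV}$ is the positive vector with $\mathbf{A}w^{EV}=\lambda_{\max}w^{EV}$, where $\lambda_{\max}$ is the largest (Perron–Frobenius) eigenvalue of $\mathbf{A}$, normalized so that $\sum_i w_i^{EV}=1$. Geometric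 mean (GM) method: $w_i^{GM}=\left(\prod_{k=1}^n a_{ik}\right)^{1/n}\Big/\sum_{j=1}^n\left(\prod_{k=1}^n a_{jk}\right)^{1/n}$, so $\sum_i w_i^{GM}=1$. $MD(u,v)=\sum_{i=1}^n|u_i-v_i|$ is the Manhattan distance. The ordinal ranking given by a priority vector $w$ orders objects by decreasing weight; the object $O_i$ is ranked first if $w_i>w_j$ for all $j\ne i$. *)

theory Defs
  imports Complex_Main "Jordan_Normal_Form.Spectral_Radius"
begin

text \<open>Objects are numbered from 0, so the object \<open>O\<^sub>1\<close> has index 0.\<close>

definition pc_matrix :: "real mat \<Rightarrow> bool" where
  "pc_matrix A \<longleftrightarrow> square_mat A \<and>
     (\<forall>i<dim_row A. \<forall>j<dim_row A. A $$ (i, j) > 0) \<and>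
     (\<forall>i<dim_row A. A $$ (i, i) = 1)"

definition reciprocal :: "real mat \<Rightarrow> bool" where
  "reciprocal A \<longleftrightarrow>
     (\<forall>i<dim_row A. \<forall>j<dim_row A. A $$ (i, j) = 1 / A $$ (j, i))"

definition KI :: "real mat \<Rightarrow> real" where
  "KI A = Max {1 - min (A $$ (i, j) / (A $$ (i, k) * A $$ (k, j)))
                       (A $$ (i, k) * A $$ (k, j) / A $$ (i, j)) | i j k.
               i < dim_row A \<and> j < dim_row A \<and> k < dim_row A}"

text \<open>The spectrum below is the set of real eigenvalues. For a positive matrix it is nonempty,
  and by the Perron--Frobenius theorem its maximum is the Perron--Frobenius eigenvalue.\<close>

definition lambda_max :: "real mat \<Rightarrow> real" where
  "lambda_max A = Max (spectrum A)"

definition ev_priority_vector :: "real mat \<Rightarrow> real vec \<Rightarrow> bool" where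
  "ev_priority_vector A w \<longleftrightarrow>
     eigenvector A w (lambda_max A) \<and>
     (\<forall>i<dim_row A. w $ i > 0) \<and>
     (\<Sum>i<dim_row A. w $ i) = 1"

definition gm_priority_vector :: "real mat \<Rightarrow> real vec" where
  "gm_priority_vector A = vec (dim_row A)
     (\<lambda>i. root (dim_row A) (\<Prod>k<dim_row A. A $$ (i, k)) /
          (\<Sum>j<dim_row A. root (dim_row A) (\<Prod>k<dim_row A. A $$ (j, k))))"

definition MD :: "real vec \<Rightarrow> real vec \<Rightarrow> real" where
  "MD u v = (\<Sum>i<dim_vec u. \<bar>u $ i - v $ i\<bar>)"

definition ranked_first :: "real vec \<Rightarrow> nat \<Rightarrow> bool" where
  "ranked_first w i \<longleftrightarrow>
     i < dim_vec w \<and> (\<forall>j<dim_vec w. j \<noteq> i \<longrightarrow> w $ i > w $ j)"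

end

theory Submission
  imports Defs
begin

text \<open>
  If a vector \<open>v\<close> reverses, or makes a tie of, a comparison \<open>u $ i > u $ j\<close>, then the two entries
  together must have moved by at least the gap \<open>u $ i - u $ j\<close>, and both moves count in \<open>MD u v\<close>.
  So a vector at Manhattan distance less than the lead of the winner of \<open>u\<close> has the same winner
  (\<open>ranked_first_if_MD_less\<close>). The two inequalities between \<open>d\<close>, \<open>1 / \<kappa>\<^sup>2 - 1\<close> and the distance
  chain to say that the lead \<open>d\<close> of the first object exceeds the distance between the
  eigenvalue and the geometric mean vectors.
\<close>

lemma MD_nonneg: "MD u v \<ge> 0"
  unfolding MD_def by (simp add: sum_nonneg)

lemma MD_ge_two_entries:
  assumes "i < dim_vec u" "j < dim_vec u" "i \<noteq> j"
  shows "\<bar>u $ i - v $ i\<bar> + \<bar>u $ j - v $ j\<bar> \<le> MD u v"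
proof -
  have "(\<Sum>k\<in>{i, j}. \<bar>u $ k - v $ k\<bar>) \<le> MD u v"
    unfolding MD_def by (rule sum_mono2) (use assms in auto)
  with \<open>i \<noteq> j\<close> show ?thesis by simp
qed

text \<open>
  The whole lead may be used up by the distance, without a factor of two, because the losses of
  entry \<open>i\<close> and the gains of entry \<open>j\<close> are separate summands of the Manhattan distance.
\<close>

lemma ranked_first_if_MD_less:
  assumes "dim_vec v = dim_vec u" and "i < dim_vec u"
    and lead: "\<And>j. j < dim_vec u \<Longrightarrow> j \<noteq> i \<Longrightarrow> u $ i - u $ j > MD u v"
  shows "ranked_first v i"
  unfolding ranked_first_def
proof (intro conjI allI impI)
  fix j assume "j < dim_vec v" "j \<noteq> i"
  with MD_ge_two_entries[of i u j v] lead[of j] assms(1,2) show "v $ i > v $ j"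
    by (simp add: abs_if split: if_splits)
qed (use assms in simp)

theorem proposition2:
  fixes n :: nat and A :: "real mat" and wEV wGM :: "real vec" and \<kappa> d :: real
  assumes "n \<ge> 2"
    and "A \<in> carrier_mat n n"
    and "pc_matrix A" and "reciprocal A"
    and "\<kappa> = 1 - KI A"
    and "ev_priority_vector A wEV"
    and "wGM = gm_priority_vector A"
    and "\<And>i j. i \<le> j \<Longrightarrow> j < n \<Longrightarrow> wEV $ i \<ge> wEV $ j"
    and "d = wEV $ 0 - wEV $ 1"
    and "d > 1 / \<kappa>\<^sup>2 - 1"
    and "1 / \<kappa>\<^sup>2 - 1 \<ge> MD wEV wGM"
  shows "ranked_first wEV 0 \<and> ranked_first wGM 0"
proof -
  have dimEV: "dim_vec wEV = n"
    using assms(2,6) unfolding ev_priority_vector_def eigenvector_def by auto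
  have dimGM: "dim_vec wGM = n"
    using assms(2,7) unfolding gm_priority_vector_def by simp
  have lead: "wEV $ 0 - wEV $ j > MD wEV wGM" if "j < n" "j \<noteq> 0" for j
    using assms(8)[of 1 j] assms(9-11) that by simp
  have "ranked_first wEV 0"
    unfolding ranked_first_def
  proof (intro conjI allI impI)
    fix j assume "j < dim_vec wEV" "j \<noteq> 0"
    with lead[of j] MD_nonneg[of wEV wGM] dimEV show "wEV $ 0 > wEV $ j" by simp
  qed (use assms(1) dimEV in simp)
  moreover have "ranked_first wGM 0"
    by (rule ranked_first_if_MD_less[of wGM wEV]) (use dimEV dimGM lead assms(1) in auto)
  ultimately show ?thesis ..
qed

end
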